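(* Let $k\in(0,1)$ and let $\varphi:[0,\infty)\times[a,\infty)\to[a,\infty)$ satisfy conditions $(\varphi_1)$, $(\varphi_2)$, $(\varphi_3)$, $(\varphi_4)$, and $(\varphi_5)$ for this $k$ (all listed in the context). Suppose $u,v\ge a$ satisfy $$u\le v\,\mathbf{o}\,\varphi(k,u).$$ Then the generalized series $\mathbf{O}_{i=0}^{\infty}\varphi(k^i,v)$ is composable following the pattern of integers $\{1\}_{n\in\mathbb{N}}$ (i.e. its right-nested partial compositions converge to a real number, denoted by the same symbol), and $$u\le \mathbf{O}_{i=0}^{\infty}\varphi(k^i,v).$$
   Context: Standing assumptions: $a\ge 0$ is a real number and $\mathbf{o}:[a,\infty)\times[a,\infty)\to[a,\infty)$, written $u\,\mathbf{o}\,v$, is a binary operation (not necessarily associative or commutative) that is nondecreasing in both variables, continuous at $(a,a)$, and satisfies $a\,\mathbf{o}\,a=a$. Series following the pattern $\{1\}_{n\in\mathbb{N}}$: for a sequence $(t_i)_{i\ge p}$ in $[a,\infty)$, the partial compositions are right-nested, i.e. $\mathbf{O}_{i=p}^{p}t_i=t_p$ and $\mathbf{O}_{i=p}^{n}t_i=t_p\,\mathbf{o}\,\big(\mathbf{O}_{i=p+1}^{n}t_i\big)$ for $n>p$. The series is called composable if the sequence $\big(\mathbf{O}_{i=p}^{n}t_i\big)_n$ converges in $\mathbb{R}$ as $n\to\infty$, and its limit is denoted $\mathbf{O}_{i=p}^{\infty}t_i$. Conditions on $\varphi:[0,\infty)\times[a,\infty)\to[a,\infty)$: - $(\varphi_1)$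 for each $r\ge0$, $u\mapsto\varphi(r,u)$ is continuous at $a$; and $\varphi$ is increasing in both variables, i.e. $r\mapsto\varphi(r,u)$ is strictly increasing on $[0,\infty)$ for each $u>a$, and $u\mapsto\varphi(r,u)$ is strictly increasing on $[a,\infty)$ for each $r>0$. - $(\varphi_2)$ $\varphi(0,u)=\varphi(r,a)=a$ for all $u\ge a$, $r\ge0$. - $(\varphi_3)$ $\varphi(r_1,\varphi(r_2,u))=\varphi(r_1r_2,u)$ for all $r_1,r_2\ge0$, $u\ge a$. - $(\varphi_4)$ $\varphi(r,u\,\mathbf{o}\,v)=\varphi(r,u)\,\mathbf{o}\,\varphi(r,v)$ for all $u,v\ge a$, $r\ge0$. - $(\varphi_5)$ (for the given $k$) for every $v\ge a$, the function $\psi(\cdot,v):[a,\infty)\to[a,\infty)$, $\psi(w,v)=v\,\mathbf{o}\,\varphi(k,w)$, has a unique fixed point $z$, and for every $w\ge a$ the $n$-th iterates of $\psi(\cdot,v)$ at $w$ converge to $z$ as $n\to\infty$. *)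

theory Defs
  imports "HOL-Analysis.Analysis"
begin

text \<open>
  The operations on \<open>[a,\<infinity>)\<close> and \<open>[0,\<infinity>) \<times> [a,\<infinity>)\<close> are total functions on the reals; every
  condition below is relativised to these carriers, so nothing is required of values outside them.
\<close>

definition composition_op :: "real \<Rightarrow> (real \<Rightarrow> real \<Rightarrow> real) \<Rightarrow> bool" where
  "composition_op a f \<longleftrightarrow>
     0 \<le> a \<and>
     f \<in> {a..} \<rightarrow> {a..} \<rightarrow> {a..} \<and>
     (\<forall>v\<in>{a..}. mono_on {a..} (\<lambda>u. f u v)) \<and>
     (\<forall>u\<in>{a..}. mono_on {a..} (\<lambda>v. f u v)) \<and>
     continuous (at (a, a) within {a..} \<times> {a..}) (\<lambda>(u, v). f u v) \<and>
     f a a = a"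

text \<open>
  Right-nested partial compositions \<open>t p \<^bold>o (t (p+1) \<^bold>o (\<dots> \<^bold>o t n))\<close> (the pattern
  with all entries 1). Only \<open>p \<le> n\<close> is meaningful; the value for \<open>n < p\<close> is arbitrary.
\<close>

function partial_comp :: "(real \<Rightarrow> real \<Rightarrow> real) \<Rightarrow> (nat \<Rightarrow> real) \<Rightarrow> nat \<Rightarrow> nat \<Rightarrow> real" where
  "partial_comp f t p n = (if p < n then f (t p) (partial_comp f t (Suc p) n) else t p)"
  by pat_completeness auto
termination
  by (relation "Wellfounded.measure (\<lambda>(f, t, p, n). n - p)") auto

declare partial_comp.simps [simp del]

definition composable :: "(real \<Rightarrow> real \<Rightarrow> real) \<Rightarrow> (nat \<Rightarrow> real) \<Rightarrow> nat \<Rightarrow> bool" where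
  "composable f t p \<longleftrightarrow> convergent (\<lambda>n. partial_comp f t p n)"

definition comp_series :: "(real \<Rightarrow> real \<Rightarrow> real) \<Rightarrow> (nat \<Rightarrow> real) \<Rightarrow> nat \<Rightarrow> real" where
  "comp_series f t p = lim (\<lambda>n. partial_comp f t p n)"

definition phi1 :: "real \<Rightarrow> (real \<Rightarrow> real \<Rightarrow> real) \<Rightarrow> bool" where
  "phi1 a \<phi> \<longleftrightarrow>
     (\<forall>r\<ge>0. continuous (at a within {a..}) (\<lambda>u. \<phi> r u)) \<and>
     (\<forall>u>a. strict_mono_on {0..} (\<lambda>r. \<phi> r u)) \<and>
     (\<forall>r>0. strict_mono_on {a..} (\<lambda>u. \<phi> r u))"

definition phi2 :: "real \<Rightarrow> (real \<Rightarrow> real \<Rightarrow> real) \<Rightarrow> bool" where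
  "phi2 a \<phi> \<longleftrightarrow> (\<forall>u\<ge>a. \<forall>r\<ge>0. \<phi> 0 u = a \<and> \<phi> r a = a)"

definition phi3 :: "real \<Rightarrow> (real \<Rightarrow> real \<Rightarrow> real) \<Rightarrow> bool" where
  "phi3 a \<phi> \<longleftrightarrow> (\<forall>r1\<ge>0. \<forall>r2\<ge>0. \<forall>u\<ge>a. \<phi> r1 (\<phi> r2 u) = \<phi> (r1 * r2) u)"

definition phi4 :: "real \<Rightarrow> (real \<Rightarrow> real \<Rightarrow> real) \<Rightarrow> (real \<Rightarrow> real \<Rightarrow> real) \<Rightarrow> bool" where
  "phi4 a f \<phi> \<longleftrightarrow> (\<forall>r\<ge>0. \<forall>u\<ge>a. \<forall>v\<ge>a. \<phi> r (f u v) = f (\<phi> r u) (\<phi> r v))"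

definition psi ::
    "(real \<Rightarrow> real \<Rightarrow> real) \<Rightarrow> (real \<Rightarrow> real \<Rightarrow> real) \<Rightarrow> real \<Rightarrow> real \<Rightarrow> real \<Rightarrow> real" where
  "psi f \<phi> k w v = f v (\<phi> k w)"

definition phi5 ::
    "real \<Rightarrow> (real \<Rightarrow> real \<Rightarrow> real) \<Rightarrow> real \<Rightarrow> (real \<Rightarrow> real \<Rightarrow> real) \<Rightarrow> bool" where
  "phi5 a f k \<phi> \<longleftrightarrow>
     (\<forall>v\<ge>a. \<exists>z\<ge>a. psi f \<phi> k z v = z \<and>
        (\<forall>y\<ge>a. psi f \<phi> k y v = y \<longrightarrow> y = z) \<and>
        (\<forall>w\<ge>a. (\<lambda>n. ((\<lambda>x. psi f \<phi> k x v) ^^ n) w) \<longlonglongrightarrow> z))"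

end

theory Submission
  imports Defs
begin

text \<open>
  By \<open>(\<phi>\<^sub>3)\<close> and \<open>(\<phi>\<^sub>4)\<close> the partial compositions are the Picard iterates of
  \<open>\<psi>(\<cdot>,v)\<close> started at \<open>v\<close>, so by \<open>(\<phi>\<^sub>5)\<close> they converge to its fixed point \<open>z\<close>. Since
  \<open>u \<le> \<psi>(u,v)\<close> and \<open>\<psi>(\<cdot>,v)\<close> is nondecreasing, \<open>u\<close> lies below all of its own iterates,
  which converge to the same \<open>z\<close>.
\<close>

text \<open>By \<open>phi3\<close>, \<open>\<phi> 1\<close> is idempotent; by strict monotonicity at
  r = 1 > 0 it is injective. An injective idempotent map is the identity.\<close>

lemma phi_one:
  assumes "phi1 a \<phi>" "phi3 a \<phi>" "\<phi> \<in> {0..} \<rightarrow> {a..} \<rightarrow> {a..}" "a \<le> x"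
  shows "\<phi> 1 x = x"
proof -
  have "a \<le> \<phi> 1 x"
    using assms(3,4) by (auto simp: Pi_iff)
  moreover have "\<phi> 1 (\<phi> 1 x) = \<phi> 1 x"
    using assms(2,4) by (auto simp: phi3_def)
  moreover have "inj_on (\<phi> 1) {a..}"
    using assms(1) by (auto simp: phi1_def intro: strict_mono_on_imp_inj_on)
  ultimately show ?thesis
    using assms(4) by (auto dest: inj_onD)
qed

lemma psi_closed:
  assumes "composition_op a f" "\<phi> \<in> {0..} \<rightarrow> {a..} \<rightarrow> {a..}" "0 \<le> k" "a \<le> v" "a \<le> w"
  shows "a \<le> psi f \<phi> k w v"
  using assms by (auto simp: composition_op_def psi_def Pi_iff)

lemma psi_mono:
  assumes "composition_op a f" "phi1 a \<phi>" "\<phi> \<in> {0..} \<rightarrow> {a..} \<rightarrow> {a..}" "0 < k"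
    and "a \<le> v" "a \<le> x" "x \<le> y"
  shows "psi f \<phi> k x v \<le> psi f \<phi> k y v"
proof -
  have "mono_on {a..} (\<phi> k)"
    using assms(2,4) by (auto simp: phi1_def intro: strict_mono_on_imp_mono_on)
  then have "\<phi> k x \<le> \<phi> k y"
    using assms(6,7) by (intro mono_onD[of _ "\<phi> k"]) auto
  moreover have "a \<le> \<phi> k x" "a \<le> \<phi> k y"
    using assms(3,4,6,7) by (auto simp: Pi_iff)
  moreover have "mono_on {a..} (f v)"
    using assms(1,5) by (auto simp: composition_op_def)
  ultimately show ?thesis
    unfolding psi_def by (intro mono_onD[of _ "f v"]) auto
qed

lemma psi_iterate_closed:
  assumes "composition_op a f" "\<phi> \<in> {0..} \<rightarrow> {a..} \<rightarrow> {a..}" "0 \<le> k" "a \<le> v" "a \<le> w"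
  shows "a \<le> ((\<lambda>x. psi f \<phi> k x v) ^^ n) w"
  using assms(5) by (induction n) (auto intro: psi_closed[OF assms(1-4)])

text \<open>The tail from \<open>p\<close> is the whole composition rescaled by
  \<open>k ^ p\<close>. Starting the iteration at \<open>v\<close> already supplies the innermost
  term, so n + 1 terms match n iterates. The induction needs every \<open>p\<close>, since unfolding
  moves the start to \<open>Suc p\<close>.\<close>

lemma partial_comp_eq_psi_iterate:
  assumes "composition_op a f" "\<phi> \<in> {0..} \<rightarrow> {a..} \<rightarrow> {a..}" "phi3 a \<phi>" "phi4 a f \<phi>"
    and "0 \<le> k" "a \<le> v"
  shows "partial_comp f (\<lambda>i. \<phi> (k ^ i) v) p (p + n) =
    \<phi> (k ^ p) (((\<lambda>x. psi f \<phi> k x v) ^^ n) v)"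
proof (induction n arbitrary: p)
  case 0
  show ?case by (subst partial_comp.simps) simp
next
  case (Suc n)
  define s where "s = ((\<lambda>x. psi f \<phi> k x v) ^^ n) v"
  have s: "a \<le> s"
    unfolding s_def using assms by (intro psi_iterate_closed) auto
  have ks: "a \<le> \<phi> k s"
    using s assms(2,5) by (auto simp: Pi_iff)
  have "partial_comp f (\<lambda>i. \<phi> (k ^ i) v) p (p + Suc n) = f (\<phi> (k ^ p) v) (\<phi> (k ^ Suc p) s)"
    using Suc.IH[of "Suc p"] by (subst partial_comp.simps) (simp add: s_def)
  \<comment> \<open>Splitting one \<open>k\<close> off by \<open>phi3\<close> gives both arguments
    of \<open>f\<close> the common scaling \<open>\<phi> (k ^ p)\<close>, which \<open>phi4\<close>
    then pulls out.\<close>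
  also have "\<phi> (k ^ Suc p) s = \<phi> (k ^ p) (\<phi> k s)"
    using assms(3,5) s by (simp add: phi3_def mult.commute)
  also have "f (\<phi> (k ^ p) v) (\<phi> (k ^ p) (\<phi> k s)) = \<phi> (k ^ p) (f v (\<phi> k s))"
    using assms(4,5,6) ks by (simp add: phi4_def)
  finally show ?case
    by (simp add: psi_def s_def)
qed

theorem theorem3p1:
  fixes a k u v :: real
    and f :: "real \<Rightarrow> real \<Rightarrow> real"
    and \<phi> :: "real \<Rightarrow> real \<Rightarrow> real"
  assumes "composition_op a f"
    and "0 < k" and "k < 1"
    and "\<phi> \<in> {0..} \<rightarrow> {a..} \<rightarrow> {a..}"
    and "phi1 a \<phi>" and "phi2 a \<phi>" and "phi3 a \<phi>" and "phi4 a f \<phi>" and "phi5 a f k \<phi>"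
    and "a \<le> u" and "a \<le> v"
    and "u \<le> f v (\<phi> k u)"
  shows "composable f (\<lambda>i. \<phi> (k ^ i) v) 0 \<and>
    u \<le> comp_series f (\<lambda>i. \<phi> (k ^ i) v) 0"
proof -
  \<comment> \<open>One \<open>z\<close> serves all starting points: the start \<open>v\<close>
    gives the series, the start \<open>u\<close> the bound.\<close>
  obtain z where z: "\<And>w. a \<le> w \<Longrightarrow> (\<lambda>n. ((\<lambda>x. psi f \<phi> k x v) ^^ n) w) \<longlonglongrightarrow> z"
    using assms(9,11) unfolding phi5_def by meson
  \<comment> \<open>At \<open>p = 0\<close> the outer scaling is \<open>\<phi> 1\<close>, which
    \<open>phi_one\<close> removes.\<close>
  have "partial_comp f (\<lambda>i. \<phi> (k ^ i) v) 0 n = ((\<lambda>x. psi f \<phi> k x v) ^^ n) v" for n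
  proof -
    have "a \<le> ((\<lambda>x. psi f \<phi> k x v) ^^ n) v"
      using assms(2) by (intro psi_iterate_closed[OF assms(1,4) _ assms(11,11)]) simp
    then have "\<phi> 1 (((\<lambda>x. psi f \<phi> k x v) ^^ n) v) = ((\<lambda>x. psi f \<phi> k x v) ^^ n) v"
      by (rule phi_one[OF assms(5,7,4)])
    moreover have "partial_comp f (\<lambda>i. \<phi> (k ^ i) v) 0 (0 + n) =
        \<phi> (k ^ 0) (((\<lambda>x. psi f \<phi> k x v) ^^ n) v)"
      using assms(2) by (intro partial_comp_eq_psi_iterate[OF assms(1,4,7,8) _ assms(11)]) simp
    ultimately show ?thesis
      by simp
  qed
  then have lim: "(\<lambda>n. partial_comp f (\<lambda>i. \<phi> (k ^ i) v) 0 n) \<longlonglongrightarrow> z"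
    using z[OF assms(11)] by simp
  have "u \<le> ((\<lambda>x. psi f \<phi> k x v) ^^ n) u" for n
  proof (induction n)
    case (Suc n)
    have "u \<le> psi f \<phi> k u v"
      using assms(12) by (simp add: psi_def)
    \<comment> \<open>Monotonicity of \<open>psi\<close> in its iterated argument, applied to the
      induction hypothesis.\<close>
    also have "\<dots> \<le> psi f \<phi> k (((\<lambda>x. psi f \<phi> k x v) ^^ n) u) v"
      using psi_mono[OF assms(1,5,4,2,11,10) Suc.IH] .
    finally show ?case by simp
  qed simp
  then have "u \<le> z"
    using z[OF assms(10)] by (intro LIMSEQ_le_const[of _ z u]) auto
  with lim show ?thesis
    unfolding composable_def comp_series_def by (metis convergentI limI)
qed

end
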